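(* Let $(W,S)$ be a Coxeter system (with $W$ not necessarily finite), and let $[u,v]_L$ and $[u',v']_L$ be elements of $\mathrm{Int}(W)$. Then $[u,v]_L$ is colored digraph isomorphic to $[u',v']_L$ if and only if $vu^{-1}=v'u'^{-1}$.
   Context: For a Coxeter system $(W,S)$, $\ell$ is the length function with respect to $S$. The left weak Bruhat order is given by $u\leq_L v$ iff $\ell(v)=\ell(u)+\ell(vu^{-1})$. For $u\leq_L v$, $[u,v]_L=\{w\in W\mid u\leq_L w\leq_L v\}$, and $\mathrm{Int}(W)=\{[u,v]_L\mid u,v\in W,\ u\leq_L v\}$. Each $I\in\mathrm{Int}(W)$ is viewed as a colored digraph: vertices are the elements of $I$, and for $w,w'\in I$, $s\in S$ there is an $s$-colored arrow $w\stackrel{s}{\longrightarrow}w'$ iff $w\leq_L w'$ and $sw=w'$. A bijection $f:I_1\to I_2$ is a colored digraph isomorphism if for all $w,w'\in I_1$ and $s\in S$: $w\stackrel{s}{\longrightarrow}w'$ iff $f(w)\stackrel{s}{\longrightarrow}f(w')$. $I_1$ is colored digraph isomorphic to $I_2$ if such an $f$ exists. *)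

theory Defs
  imports "HOL-Algebra.Algebra" "HOL-Library.Extended_Nat"
begin

text \<open>Group presentations. A word in the letters \<open>S\<close> and their formal inverses is a list of
  pairs \<open>(s, b)\<close>, where \<open>b\<close> is \<open>True\<close> for \<open>s\<close> and \<open>False\<close> for the formal inverse of \<open>s\<close>.\<close>

type_synonym 'a gword = "('a \<times> bool) list"

definition words_over :: "'a set \<Rightarrow> 'a gword set" where
  "words_over S = lists (S \<times> UNIV)"

primrec eval_word :: "('a, 'b) monoid_scheme \<Rightarrow> 'a gword \<Rightarrow> 'a" where
  "eval_word G [] = \<one>\<^bsub>G\<^esub>"
| "eval_word G (x # w) = (if snd x then fst x else inv\<^bsub>G\<^esub> (fst x)) \<otimes>\<^bsub>G\<^esub> eval_word G w"

text \<open>Equality of two words in the abstract group with generators \<open>S\<close> and relators \<open>R\<close>.\<close>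

inductive pres_eq :: "'a set \<Rightarrow> 'a gword set \<Rightarrow> 'a gword \<Rightarrow> 'a gword \<Rightarrow> bool"
  for S :: "'a set" and R :: "'a gword set" where
  refl: "w \<in> words_over S \<Longrightarrow> pres_eq S R w w"
| sym: "pres_eq S R w w' \<Longrightarrow> pres_eq S R w' w"
| trans: "pres_eq S R w w' \<Longrightarrow> pres_eq S R w' w'' \<Longrightarrow> pres_eq S R w w''"
| cancel: "x \<in> words_over S \<Longrightarrow> y \<in> words_over S \<Longrightarrow> s \<in> S \<Longrightarrow>
    pres_eq S R (x @ [(s, b), (s, \<not> b)] @ y) (x @ y)"
| relator: "x \<in> words_over S \<Longrightarrow> y \<in> words_over S \<Longrightarrow> r \<in> R \<Longrightarrow>
    pres_eq S R (x @ r @ y) (x @ y)"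

text \<open>\<open>S\<close> generates \<open>G\<close>, and the kernel of the evaluation map from the free group on \<open>S\<close> is the
  normal closure of \<open>R\<close>.\<close>

definition has_presentation ::
    "('a, 'b) monoid_scheme \<Rightarrow> 'a set \<Rightarrow> 'a gword set \<Rightarrow> bool" where
  "has_presentation G S R \<longleftrightarrow>
     group G \<and> S \<subseteq> carrier G \<and> generate G S = carrier G \<and> R \<subseteq> words_over S \<and>
     (\<forall>w \<in> words_over S. eval_word G w = \<one>\<^bsub>G\<^esub> \<longleftrightarrow> pres_eq S R w [])"

definition coxeter_matrix :: "'a set \<Rightarrow> ('a \<Rightarrow> 'a \<Rightarrow> enat) \<Rightarrow> bool" where
  "coxeter_matrix S m \<longleftrightarrow>
     (\<forall>s\<in>S. \<forall>t\<in>S. m s t = m t s \<and> 1 \<le> m s t \<and> (m s t = 1 \<longleftrightarrow> s = t))"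

text \<open>The relators \<open>(s t)\<^sup>m\<close> with \<open>m = m(s, t)\<close>; there is none for a pair with \<open>m(s, t) = \<infinity>\<close>.\<close>

definition coxeter_relators :: "'a set \<Rightarrow> ('a \<Rightarrow> 'a \<Rightarrow> enat) \<Rightarrow> 'a gword set" where
  "coxeter_relators S m =
     {concat (replicate n [(s, True), (t, True)]) | s t n. s \<in> S \<and> t \<in> S \<and> m s t = enat n}"

text \<open>Neither \<open>S\<close> nor the group is required to be finite.\<close>

definition coxeter_system :: "('a, 'b) monoid_scheme \<Rightarrow> 'a set \<Rightarrow> bool" where
  "coxeter_system W S \<longleftrightarrow>
     (\<exists>m. coxeter_matrix S m \<and> has_presentation W S (coxeter_relators S m))"

text \<open>Only positive words are used, the elements of \<open>S\<close> being involutions.\<close>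

definition cox_length :: "('a, 'b) monoid_scheme \<Rightarrow> 'a set \<Rightarrow> 'a \<Rightarrow> nat" where
  "cox_length W S w =
     (LEAST n. \<exists>ss. set ss \<subseteq> S \<and> length ss = n \<and> foldr (\<otimes>\<^bsub>W\<^esub>) ss \<one>\<^bsub>W\<^esub> = w)"

definition left_weak_le :: "('a, 'b) monoid_scheme \<Rightarrow> 'a set \<Rightarrow> 'a \<Rightarrow> 'a \<Rightarrow> bool" where
  "left_weak_le W S u v \<longleftrightarrow>
     cox_length W S v = cox_length W S u + cox_length W S (v \<otimes>\<^bsub>W\<^esub> inv\<^bsub>W\<^esub> u)"

definition left_interval :: "('a, 'b) monoid_scheme \<Rightarrow> 'a set \<Rightarrow> 'a \<Rightarrow> 'a \<Rightarrow> 'a set" where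
  "left_interval W S u v =
     {w \<in> carrier W. left_weak_le W S u w \<and> left_weak_le W S w v}"

text \<open>The \<open>s\<close>-colored arrow from \<open>w\<close> to \<open>w'\<close>; in the digraph of an interval \<open>I\<close> it is only
  used for \<open>w\<close> and \<open>w'\<close> in \<open>I\<close>.\<close>

definition colored_arrow :: "('a, 'b) monoid_scheme \<Rightarrow> 'a set \<Rightarrow> 'a \<Rightarrow> 'a \<Rightarrow> 'a \<Rightarrow> bool" where
  "colored_arrow W S s w w' \<longleftrightarrow> left_weak_le W S w w' \<and> s \<otimes>\<^bsub>W\<^esub> w = w'"

definition colored_digraph_iso ::
    "('a, 'b) monoid_scheme \<Rightarrow> 'a set \<Rightarrow> 'a set \<Rightarrow> 'a set \<Rightarrow> ('a \<Rightarrow> 'a) \<Rightarrow> bool" where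
  "colored_digraph_iso W S I1 I2 f \<longleftrightarrow>
     bij_betw f I1 I2 \<and>
     (\<forall>w\<in>I1. \<forall>w'\<in>I1. \<forall>s\<in>S. colored_arrow W S s w w' \<longleftrightarrow> colored_arrow W S s (f w) (f w'))"

definition colored_digraph_isomorphic ::
    "('a, 'b) monoid_scheme \<Rightarrow> 'a set \<Rightarrow> 'a set \<Rightarrow> 'a set \<Rightarrow> bool" where
  "colored_digraph_isomorphic W S I1 I2 \<longleftrightarrow> (\<exists>f. colored_digraph_iso W S I1 I2 f)"

end

theory Submission
  imports Defs
begin

text \<open>Put \<open>x = v u\<inverse>\<close> and \<open>x' = v' u'\<inverse>\<close>. Right translation by \<open>u\<inverse> u'\<close> maps \<open>[u, x u]\<close> onto
  \<open>[u', x u']\<close>, since additivity of lengths only depends on the triangle inequality. Conversely, a map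
  \<open>f\<close> preserving coloured arrows follows a reduced word of \<open>y u\<inverse>\<close> from \<open>u\<close> to \<open>y\<close>, so it satisfies
  \<open>f y = y u\<inverse> f u\<close> and \<open>\<ell>(f y) = \<ell>(f u) + \<ell>(y u\<inverse>)\<close>. Hence \<open>\<ell>(x) \<le> \<ell>(x')\<close>; applying this
  also to the inverse map gives equality, which forces \<open>f u = u'\<close> and \<open>f v = v'\<close>, so
  \<open>v' = x u'\<close>. Of the Coxeter relations only \<open>s\<^sup>2 = 1\<close> is used.\<close>

section \<open>Word length in a group with a symmetric generating set\<close>

locale symmetric_generators = group W for W :: "('a, 'b) monoid_scheme" (structure) +
  fixes S :: "'a set"
  assumes gens_closed: "S \<subseteq> carrier W"
    and gens_generate: "generate W S = carrier W"
    and gens_inv: "s \<in> S \<Longrightarrow> inv s \<in> S"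
begin

abbreviation word_prod :: "'a list \<Rightarrow> 'a" where
  "word_prod ss \<equiv> foldr (\<otimes>) ss \<one>"

abbreviation len :: "'a \<Rightarrow> nat" where
  "len \<equiv> cox_length W S"

lemma word_prod_closed: "set ss \<subseteq> S \<Longrightarrow> word_prod ss \<in> carrier W"
  using gens_closed by (induction ss) auto

lemma word_prod_append:
  assumes "set ss \<subseteq> S" "set ts \<subseteq> S"
  shows "word_prod (ss @ ts) = word_prod ss \<otimes> word_prod ts"
  using assms(1)
proof (induction ss)
  case Nil
  then show ?case using word_prod_closed[OF assms(2)] by simp
next
  case (Cons s ss)
  then show ?case
    using word_prod_closed[OF assms(2)] word_prod_closed[of ss] gens_closed
    by (auto simp: m_assoc)
qed

text \<open>Closure of \<open>S\<close> under inverses replaces each inverse letter by a letter of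
  \<open>S\<close>, so group generation already yields positive words, the only ones that
  \<open>cox_length\<close> counts.\<close>

lemma word_exists:
  assumes "w \<in> carrier W"
  shows "\<exists>ss. set ss \<subseteq> S \<and> word_prod ss = w"
proof -
  have "w \<in> generate W S" using assms gens_generate by simp
  then show ?thesis
  proof (induction rule: generate.induct)
    case one
    show ?case by (intro exI[of _ "[]"]) simp
  next
    case (incl s)
    then show ?case using gens_closed by (intro exI[of _ "[s]"]) auto
  next
    case (inv s)
    then show ?case using gens_closed gens_inv by (intro exI[of _ "[inv s]"]) auto
  next
    case (eng w1 w2)
    then obtain ss ts where "set ss \<subseteq> S" "word_prod ss = w1" "set ts \<subseteq> S" "word_prod ts = w2"
      by blast
    then show ?case by (intro exI[of _ "ss @ ts"]) (simp add: word_prod_append del: foldr_append)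
  qed
qed

text \<open>Existence of a word is what makes the \<open>LEAST\<close> in \<open>cox_length\<close>
  attained.\<close>

lemma reduced_word:
  assumes "w \<in> carrier W"
  obtains ss where "set ss \<subseteq> S" "length ss = len w" "word_prod ss = w"
proof -
  have "\<exists>n ss. set ss \<subseteq> S \<and> length ss = n \<and> word_prod ss = w"
    using word_exists[OF assms] by blast
  from LeastI_ex[OF this] show thesis
    using that unfolding cox_length_def by blast
qed

lemma len_word_prod_le: "set ss \<subseteq> S \<Longrightarrow> len (word_prod ss) \<le> length ss"
  unfolding cox_length_def by (rule Least_le) blast

lemma len_one [simp]: "len \<one> = 0"
  using len_word_prod_le[of "[]"] by simp

text \<open>Only an inequality, since the locale does not exclude \<open>\<one>\<close> from
  \<open>S\<close>.\<close>

lemma len_gen_le: "s \<in> S \<Longrightarrow> len s \<le> 1"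
  using len_word_prod_le[of "[s]"] gens_closed by auto

lemma len_eq_0D:
  assumes "w \<in> carrier W" "len w = 0"
  shows "w = \<one>"
  using reduced_word[OF assms(1)] assms(2) by (metis foldr_Nil id_apply length_0_conv)

lemma len_mult_le:
  assumes "x \<in> carrier W" "y \<in> carrier W"
  shows "len (x \<otimes> y) \<le> len x + len y"
proof -
  obtain ss ts where "set ss \<subseteq> S" "length ss = len x" "word_prod ss = x"
    "set ts \<subseteq> S" "length ts = len y" "word_prod ts = y"
    using reduced_word assms by metis
  then show ?thesis
    using len_word_prod_le[of "ss @ ts"] word_prod_append[of ss ts] by simp
qed

text \<open>Split off the first letter of a reduced word. The factors have lengths at most 1 and
  \<open>n\<close>, and by the triangle inequality these bounds are attained.\<close>

lemma left_factor:
  assumes "x \<in> carrier W" "len x = Suc n"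
  obtains s y where "s \<in> S" "y \<in> carrier W" "x = s \<otimes> y" "len s = 1" "len y = n"
proof -
  obtain ss where ss: "set ss \<subseteq> S" "length ss = len x" "word_prod ss = x"
    using reduced_word[OF assms(1)] .
  then obtain s ts where eq: "ss = s # ts" using assms(2) by (cases ss) auto
  have s: "s \<in> S" and ts: "set ts \<subseteq> S" using ss eq by auto
  have x: "x = s \<otimes> word_prod ts" using ss eq by simp
  have y: "word_prod ts \<in> carrier W" using ts by (rule word_prod_closed)
  have "len (word_prod ts) \<le> n" using len_word_prod_le[OF ts] ss eq assms(2) by simp
  moreover have "Suc n \<le> len s + len (word_prod ts)"
    using len_mult_le[of s "word_prod ts"] s y gens_closed x assms(2) by auto
  ultimately show thesis
    using that[OF s y x] len_gen_le[OF s] by linarith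
qed

section \<open>The left weak order and right translation of intervals\<close>

lemma left_weak_leD:
  "left_weak_le W S u v \<Longrightarrow> len v = len u + len (v \<otimes> inv u)"
  by (simp add: left_weak_le_def)

lemma left_weak_le_refl: "w \<in> carrier W \<Longrightarrow> left_weak_le W S w w"
  by (simp add: left_weak_le_def)

text \<open>The opposite inequality is the triangle inequality for
  \<open>v = (v \<otimes> inv u) \<otimes> u\<close>.\<close>

lemma left_weak_le_iff:
  assumes "u \<in> carrier W" "v \<in> carrier W"
  shows "left_weak_le W S u v \<longleftrightarrow> len u + len (v \<otimes> inv u) \<le> len v"
proof -
  have "v \<otimes> inv u \<otimes> u = v" using assms by (simp add: m_assoc)
  then have "len v \<le> len (v \<otimes> inv u) + len u"
    using len_mult_le[of "v \<otimes> inv u" u] assms by simp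
  then show ?thesis by (auto simp: left_weak_le_def)
qed

lemma left_weak_le_same_lenD:
  assumes "u \<in> carrier W" "v \<in> carrier W" "left_weak_le W S u v" "len u = len v"
  shows "u = v"
proof -
  have "v \<otimes> inv u = \<one>"
    using assms left_weak_leD[OF assms(3)] by (intro len_eq_0D) auto
  then have "v = \<one> \<otimes> u" using assms(1,2) inv_solve_right'[of \<one> v u] by simp
  then show ?thesis using assms(1) by simp
qed

lemma mult_inv_mult:
  assumes "x \<in> carrier W" "y \<in> carrier W" "u \<in> carrier W"
  shows "x \<otimes> u \<otimes> inv (y \<otimes> u) = x \<otimes> inv y"
proof -
  have "x \<otimes> u \<otimes> inv (y \<otimes> u) = x \<otimes> (u \<otimes> (inv u \<otimes> inv y))"
    using assms by (simp add: inv_mult_group m_assoc)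
  also have "u \<otimes> (inv u \<otimes> inv y) = inv y"
    using assms by (simp flip: m_assoc)
  finally show ?thesis .
qed

text \<open>Reduces every interval to one starting at \<open>\<one>\<close>. The second claim says
  that translation shifts all lengths by the constant \<open>len u\<close>, which is what the
  comparison of arrows uses.\<close>

lemma left_interval_translate:
  assumes u: "u \<in> carrier W" and x: "x \<in> carrier W" and le: "left_weak_le W S u (x \<otimes> u)"
  shows "left_interval W S u (x \<otimes> u) = (\<lambda>y. y \<otimes> u) ` left_interval W S \<one> x"
    (is "?I = ?J")
    and "y \<in> left_interval W S \<one> x \<Longrightarrow> len (y \<otimes> u) = len y + len u"
proof -
  have xu: "x \<otimes> u \<otimes> inv u = x" using u x by (simp add: m_assoc)
  have lx: "len (x \<otimes> u) = len u + len x" using left_weak_leD[OF le] xu by simp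
  have fwd: "y \<in> left_interval W S \<one> x" if "y \<otimes> u \<in> ?I" and y: "y \<in> carrier W" for y
  proof -
    have "y \<otimes> u \<otimes> inv u = y" using u y by (simp add: m_assoc)
    \<comment> \<open>Combined with \<open>lx\<close>, these equations give
      \<open>len x = len y + len (x \<otimes> inv y)\<close> after \<open>len u\<close> is
      cancelled.\<close>
    then have "len (y \<otimes> u) = len u + len y"
      "len (x \<otimes> u) = len (y \<otimes> u) + len (x \<otimes> inv y)"
      using that mult_inv_mult[OF x y u] by (auto simp: left_interval_def left_weak_le_def)
    then show ?thesis
      using lx x y by (simp add: left_interval_def left_weak_le_def)
  qed
  have bwd: "y \<otimes> u \<in> ?I \<and> len (y \<otimes> u) = len y + len u"
    if yI: "y \<in> left_interval W S \<one> x" for y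
  proof -
    have y: "y \<in> carrier W" and ly: "len x = len y + len (x \<otimes> inv y)"
      using yI left_weak_leD by (auto simp: left_interval_def)
    have yu: "y \<otimes> u \<otimes> inv u = y" using u y by (simp add: m_assoc)
    have e: "x \<otimes> inv y \<otimes> (y \<otimes> u) = x \<otimes> u"
      using inv_solve_right[of "x \<otimes> inv y" "x \<otimes> u" "y \<otimes> u"] x y u
      by (simp add: mult_inv_mult)
    \<comment> \<open>By \<open>lx\<close> and \<open>ly\<close>, \<open>len (x \<otimes> u)\<close>
      equals \<open>len (x \<otimes> inv y) + len y + len u\<close>, so this bound and the next one
      are both equalities.\<close>
    have "len (x \<otimes> u) \<le> len (x \<otimes> inv y) + len (y \<otimes> u)"
      using len_mult_le[of "x \<otimes> inv y" "y \<otimes> u"] e x y u by simp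
    moreover have "len (y \<otimes> u) \<le> len y + len u" using len_mult_le y u by blast
    ultimately show ?thesis
      using lx ly u y yu mult_inv_mult[OF x y u] by (simp add: left_interval_def left_weak_le_def)
  qed
  show "?I = ?J"
  proof
    show "?J \<subseteq> ?I" using bwd by blast
    show "?I \<subseteq> ?J"
    proof
      fix w assume w: "w \<in> ?I"
      then have wc: "w \<in> carrier W" by (simp add: left_interval_def)
      then have "w \<otimes> inv u \<otimes> u = w" using u by (simp add: m_assoc)
      then show "w \<in> ?J"
        using fwd[of "w \<otimes> inv u"] w wc u by (metis imageI inv_closed m_closed)
    qed
  qed
  show "y \<in> left_interval W S \<one> x \<Longrightarrow> len (y \<otimes> u) = len y + len u"
    using bwd by blast
qed

text \<open>The map sends \<open>y \<otimes> u\<close> to \<open>y \<otimes> u'\<close>, so both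
  intervals are compared as translates of \<open>[\<one>, x]\<close>.\<close>

lemma colored_digraph_iso_translate:
  assumes u: "u \<in> carrier W" and u': "u' \<in> carrier W" and x: "x \<in> carrier W"
    and le: "left_weak_le W S u (x \<otimes> u)" and le': "left_weak_le W S u' (x \<otimes> u')"
  shows "colored_digraph_iso W S (left_interval W S u (x \<otimes> u)) (left_interval W S u' (x \<otimes> u'))
    (\<lambda>w. w \<otimes> inv u \<otimes> u')"
  (is "colored_digraph_iso W S ?I ?I' ?f")
proof -
  let ?K = "left_interval W S \<one> x"
  have K: "?K \<subseteq> carrier W" by (auto simp: left_interval_def)
  note I = left_interval_translate[OF u x le]
  note I' = left_interval_translate[OF u' x le']
  have f: "?f (y \<otimes> u) = y \<otimes> u'" if "y \<in> ?K" for y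
    using that K u u' by (auto simp: m_assoc subset_iff)
  have inj: "inj_on (\<lambda>y. y \<otimes> g) ?K" if "g \<in> carrier W" for g
    using K that by (intro inj_onI) (auto simp: subset_iff)
  have "bij_betw ?f ?I ?I'"
  proof (rule bij_betw_imageI)
    show "inj_on ?f ?I"
    proof (rule inj_onI)
      fix w w' assume w: "w \<in> ?I" "w' \<in> ?I" and eq: "?f w = ?f w'"
      have "w \<in> carrier W" "w' \<in> carrier W" using w by (auto simp: left_interval_def)
      then show "w = w'" using eq u u' by simp
    qed
    show "?f ` ?I = ?I'"
      unfolding I(1) I'(1) image_image using f by (rule image_cong[OF HOL.refl])
  qed
  \<comment> \<open>For \<open>g\<close> equal to \<open>u\<close> or \<open>u'\<close>, the order
    part of an arrow reads \<open>len (z \<otimes> g) = len (y \<otimes> g) + len (z \<otimes> inv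
    y)\<close>. Here \<open>len g\<close> cancels, leaving a condition on \<open>y\<close> and
    \<open>z\<close> alone.\<close>
  moreover have "colored_arrow W S s (y \<otimes> u) (z \<otimes> u) \<longleftrightarrow> colored_arrow W S s (y \<otimes> u') (z \<otimes> u')"
    if s: "s \<in> S" and y: "y \<in> ?K" and z: "z \<in> ?K" for s y z
  proof -
    have c: "s \<in> carrier W" "y \<in> carrier W" "z \<in> carrier W" using s y z K gens_closed by auto
    have "s \<otimes> (y \<otimes> g) = z \<otimes> g \<longleftrightarrow> s \<otimes> y = z" if "g \<in> carrier W" for g
      using c that by (simp flip: m_assoc)
    then show ?thesis
      using c u u' I(2)[OF y] I(2)[OF z] I'(2)[OF y] I'(2)[OF z]
      by (simp add: colored_arrow_def left_weak_le_def mult_inv_mult)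
  qed
  ultimately show ?thesis
    unfolding colored_digraph_iso_def I(1) using f by auto
qed

section \<open>Rigidity of color-preserving isomorphisms\<close>

lemma left_weak_le_lower_cover:
  assumes u: "u \<in> carrier W" and v: "v \<in> carrier W" and y: "y \<in> left_interval W S u v"
    and n: "len (y \<otimes> inv u) = Suc n"
  obtains s w where "s \<in> S" "len s = 1" "w \<in> left_interval W S u v" "len (w \<otimes> inv u) = n"
    "y = s \<otimes> w" "colored_arrow W S s w y"
proof -
  have yc: "y \<in> carrier W" using y by (simp add: left_interval_def)
  obtain s z where s: "s \<in> S" and z: "z \<in> carrier W" and yz: "y \<otimes> inv u = s \<otimes> z"
    and ls: "len s = 1" and lz: "len z = n"
    using left_factor[OF _ n] yc u by auto
  have sc: "s \<in> carrier W" using s gens_closed by auto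
  \<comment> \<open>\<open>w\<close> arises from \<open>y\<close> by removing the first letter of a
    reduced word of \<open>y \<otimes> inv u\<close>.\<close>
  define w where "w = z \<otimes> u"
  have wc: "w \<in> carrier W" using z u by (simp add: w_def)
  have wu: "w \<otimes> inv u = z" using z u by (simp add: w_def m_assoc)
  have "y = y \<otimes> inv u \<otimes> u" using yc u by (simp add: m_assoc)
  then have yw: "y = s \<otimes> w" using sc z u by (simp add: yz w_def m_assoc)
  have yws: "y \<otimes> inv w = s" using yw sc wc by (simp add: m_assoc)
  have ly: "len y = len u + Suc n" and lv: "len v = len y + len (v \<otimes> inv y)"
    using y n by (auto simp: left_interval_def left_weak_le_def)
  \<comment> \<open>The two bounds on the steps from \<open>u\<close> to \<open>w\<close> and from
    \<open>w\<close> to \<open>y\<close> add up to exactly \<open>len y - len u\<close>, which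
    determines \<open>len w\<close>.\<close>
  have "len y \<le> 1 + len w" using len_mult_le[OF sc wc] ls yw by simp
  moreover have "len w \<le> n + len u" using len_mult_le[OF z u] lz w_def by simp
  ultimately have lw: "len w = len u + n" using ly by simp
  \<comment> \<open>Going from \<open>w\<close> to \<open>v\<close> through \<open>y\<close> costs
    one more letter, while \<open>w\<close> is one shorter than \<open>y\<close>; hence
    \<open>w\<close> stays below \<open>v\<close>.\<close>
  have "v \<otimes> inv y \<otimes> s = v \<otimes> inv w"
    using v sc wc by (simp add: yw inv_mult_group m_assoc)
  then have "len (v \<otimes> inv w) \<le> len (v \<otimes> inv y) + 1"
    using len_mult_le[of "v \<otimes> inv y" s] v yc sc ls by simp
  then have "left_weak_le W S w v"
    using left_weak_le_iff[OF wc v] lv ly lw by simp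
  moreover have "left_weak_le W S u w"
    using lw lz wu by (simp add: left_weak_le_def)
  ultimately have "w \<in> left_interval W S u v"
    using wc by (simp add: left_interval_def)
  moreover have "colored_arrow W S s w y"
    using yw yws ly lw ls by (simp add: colored_arrow_def left_weak_le_def)
  ultimately show thesis using that s ls wu lz yw by blast
qed

context
  fixes u v u' v' :: 'a and f
  assumes u: "u \<in> carrier W" and v: "v \<in> carrier W" and le: "left_weak_le W S u v"
    and u': "u' \<in> carrier W" and v': "v' \<in> carrier W" and le': "left_weak_le W S u' v'"
    and iso: "colored_digraph_iso W S (left_interval W S u v) (left_interval W S u' v') f"
begin

lemma colored_digraph_iso_closed:
  "y \<in> left_interval W S u v \<Longrightarrow> f y \<in> left_interval W S u' v'"
  using iso by (auto simp: colored_digraph_iso_def bij_betw_def)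

lemma lower_in_left_interval: "u \<in> left_interval W S u v"
  using u le by (simp add: left_interval_def left_weak_le_refl)

lemma upper_in_left_interval: "v \<in> left_interval W S u v"
  using v le by (simp add: left_interval_def left_weak_le_refl)

text \<open>Induction on \<open>len (y \<otimes> inv u)\<close>: \<open>f\<close> carries the arrow
  from a lower cover \<open>w\<close> into \<open>y\<close> to an arrow of the same color, so both
  \<open>y\<close> and \<open>f y\<close> arise by left multiplication with the same letter.\<close>

lemma colored_digraph_iso_along_path:
  assumes "y \<in> left_interval W S u v"
  shows "f y = y \<otimes> inv u \<otimes> f u \<and> len (f y) = len (f u) + len (y \<otimes> inv u)"
  using assms
proof (induction "len (y \<otimes> inv u)" arbitrary: y)
  case 0
  have yc: "y \<in> carrier W" using 0 by (simp add: left_interval_def)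
  have "u = y"
    using 0 yc u by (intro left_weak_le_same_lenD) (auto simp: left_interval_def left_weak_le_def)
  moreover have "f u \<in> carrier W"
    using colored_digraph_iso_closed[OF lower_in_left_interval] by (simp add: left_interval_def)
  ultimately show ?case using u by simp
next
  case (Suc n)
  obtain s w where s: "s \<in> S" and ls: "len s = 1" and w: "w \<in> left_interval W S u v"
    and lw: "len (w \<otimes> inv u) = n" and yw: "y = s \<otimes> w" and arr: "colored_arrow W S s w y"
    using left_weak_le_lower_cover[OF u v Suc.prems Suc.hyps(2)[symmetric]] by blast
  have "colored_arrow W S s (f w) (f y)"
    using iso s w arr Suc.prems by (auto simp: colored_digraph_iso_def)
  then have fy: "f y = s \<otimes> f w" and lfy: "len (f y) = len (f w) + len (f y \<otimes> inv f w)"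
    by (auto simp: colored_arrow_def left_weak_le_def)
  have c: "s \<in> carrier W" "w \<in> carrier W" "f w \<in> carrier W" "f u \<in> carrier W"
    using s gens_closed w colored_digraph_iso_closed[OF w]
      colored_digraph_iso_closed[OF lower_in_left_interval] by (auto simp: left_interval_def)
  \<comment> \<open>The image arrow has quotient \<open>s\<close> of length 1, so the length grows
    by exactly one.\<close>
  have "f y \<otimes> inv f w = s" using fy c by (simp add: m_assoc)
  then have "len (f y) = len (f w) + 1" using lfy ls by simp
  moreover have IH: "f w = w \<otimes> inv u \<otimes> f u" "len (f w) = len (f u) + len (w \<otimes> inv u)"
    using Suc.hyps(1)[OF lw[symmetric] w] by auto
  moreover have "f y = y \<otimes> inv u \<otimes> f u"
    using fy c u by (simp add: IH(1) yw m_assoc)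
  ultimately show ?case using lw Suc.hyps(2) by simp
qed

text \<open>The inequalities hold because \<open>f u\<close> and \<open>f v\<close> lie in the
  target interval; the equation is the path formula at \<open>v\<close>.\<close>

lemma colored_digraph_iso_len_bounds:
  "len u' \<le> len (f u)" "len (f v) \<le> len v'" "len (f v) = len (f u) + len (v \<otimes> inv u)"
  using colored_digraph_iso_closed[OF lower_in_left_interval]
    colored_digraph_iso_closed[OF upper_in_left_interval]
    colored_digraph_iso_along_path[OF upper_in_left_interval]
  by (auto simp: left_interval_def left_weak_le_def)

lemma colored_digraph_iso_len_le: "len (v \<otimes> inv u) \<le> len (v' \<otimes> inv u')"
  using colored_digraph_iso_len_bounds left_weak_leD[OF le'] by linarith

lemma colored_digraph_iso_quotient_eq:
  assumes eq: "len (v \<otimes> inv u) = len (v' \<otimes> inv u')"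
  shows "v \<otimes> inv u = v' \<otimes> inv u'"
proof -
  \<comment> \<open>Equal quotient lengths leave no slack in the bounds, and an interval element as
    long as an endpoint is that endpoint.\<close>
  have "len u' = len (f u)" and "len (f v) = len v'"
    using colored_digraph_iso_len_bounds left_weak_leD[OF le'] eq by linarith+
  then have "u' = f u" and "f v = v'"
    using colored_digraph_iso_closed[OF lower_in_left_interval]
      colored_digraph_iso_closed[OF upper_in_left_interval] u' v' left_weak_le_same_lenD
    by (auto simp: left_interval_def)
  then have "v' = v \<otimes> inv u \<otimes> u'"
    using colored_digraph_iso_along_path[OF upper_in_left_interval] by simp
  then show ?thesis using u v u' by (simp add: m_assoc)
qed

end

text \<open>Supplies the length inequality in the opposite direction.\<close>

lemma colored_digraph_iso_inv:
  assumes "colored_digraph_iso W S I J f"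
  shows "colored_digraph_iso W S J I (inv_into I f)"
proof -
  have bij: "bij_betw f I J" using assms by (simp add: colored_digraph_iso_def)
  then have "inv_into I f w \<in> I" "f (inv_into I f w) = w" if "w \<in> J" for w
    using that by (auto simp: bij_betw_def inv_into_into f_inv_into_f)
  then show ?thesis
    using assms bij_betw_inv_into[OF bij] by (simp add: colored_digraph_iso_def)
qed

lemma colored_digraph_isomorphic_iff:
  assumes u: "u \<in> carrier W" and v: "v \<in> carrier W" and le: "left_weak_le W S u v"
    and u': "u' \<in> carrier W" and v': "v' \<in> carrier W" and le': "left_weak_le W S u' v'"
  shows "colored_digraph_isomorphic W S (left_interval W S u v) (left_interval W S u' v') \<longleftrightarrow>
    v \<otimes> inv u = v' \<otimes> inv u'"
proof
  assume "colored_digraph_isomorphic W S (left_interval W S u v) (left_interval W S u' v')"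
  then obtain f where
    f: "colored_digraph_iso W S (left_interval W S u v) (left_interval W S u' v') f"
    by (auto simp: colored_digraph_isomorphic_def)
  have "len (v \<otimes> inv u) = len (v' \<otimes> inv u')"
    using colored_digraph_iso_len_le[OF u v le u' v' le' f]
      colored_digraph_iso_len_le[OF u' v' le' u v le colored_digraph_iso_inv[OF f]] by simp
  then show "v \<otimes> inv u = v' \<otimes> inv u'"
    by (rule colored_digraph_iso_quotient_eq[OF u v le u' v' le' f])
next
  assume eq: "v \<otimes> inv u = v' \<otimes> inv u'"
  define x where "x = v \<otimes> inv u"
  have "v = x \<otimes> u"
    using u v by (simp add: x_def m_assoc)
  moreover have "v' = x \<otimes> u'"
    using u' v' by (simp add: x_def eq m_assoc)
  moreover have "x \<in> carrier W"
    using u v by (simp add: x_def)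
  ultimately show "colored_digraph_isomorphic W S (left_interval W S u v) (left_interval W S u' v')"
    using colored_digraph_iso_translate[OF u u', of x] le le'
    by (auto simp: colored_digraph_isomorphic_def)
qed

end

section \<open>Coxeter systems as symmetric generating sets\<close>

lemma coxeter_system_involution:
  assumes "coxeter_system W S" "s \<in> S"
  shows "s \<otimes>\<^bsub>W\<^esub> s = \<one>\<^bsub>W\<^esub>"
proof -
  obtain m where m: "coxeter_matrix S m" and pres: "has_presentation W S (coxeter_relators S m)"
    using assms(1) by (auto simp: coxeter_system_def)
  interpret group W using pres by (simp add: has_presentation_def)
  let ?r = "[(s, True), (s, True)]"
  \<comment> \<open>The diagonal entry 1 makes \<open>s s\<close> itself a relator; the form
    \<open>enat 1\<close> matches the exponent in \<open>coxeter_relators\<close>.\<close>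
  have "m s s = enat 1" using m assms(2) by (simp add: coxeter_matrix_def one_enat_def)
  then have "?r \<in> coxeter_relators S m"
    using assms(2) unfolding coxeter_relators_def
    by (intro CollectI exI[of _ s] exI[of _ 1]) simp
  then have "pres_eq S (coxeter_relators S m) ?r []"
    using pres_eq.relator[of "[]" S "[]"] by (simp add: words_over_def)
  moreover have "?r \<in> words_over S" using assms(2) by (simp add: words_over_def)
  ultimately have "eval_word W ?r = \<one>\<^bsub>W\<^esub>" using pres by (auto simp: has_presentation_def)
  moreover have "s \<in> carrier W" using pres assms(2) by (auto simp: has_presentation_def)
  ultimately show ?thesis by simp
qed

lemma coxeter_system_symmetric_generators:
  assumes "coxeter_system W S"
  shows "symmetric_generators W S"
proof -
  obtain R where pres: "has_presentation W S R"
    using assms by (auto simp: coxeter_system_def)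
  interpret group W using pres by (simp add: has_presentation_def)
  show ?thesis
  proof
    show "S \<subseteq> carrier W" "generate W S = carrier W"
      using pres by (auto simp: has_presentation_def)
    \<comment> \<open>An involution is its own inverse.\<close>
    show "inv\<^bsub>W\<^esub> s \<in> S" if "s \<in> S" for s
      using that \<open>S \<subseteq> carrier W\<close> coxeter_system_involution[OF assms that]
      by (metis inv_equality subsetD)
  qed
qed

theorem proposition3p5:
  fixes W :: "('a, 'b) monoid_scheme" and S :: "'a set" and u v u' v' :: 'a
  assumes "coxeter_system W S"
    and "u \<in> carrier W" and "v \<in> carrier W" and "left_weak_le W S u v"
    and "u' \<in> carrier W" and "v' \<in> carrier W" and "left_weak_le W S u' v'"
  shows "colored_digraph_isomorphic W S (left_interval W S u v) (left_interval W S u' v') \<longleftrightarrow>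
         v \<otimes>\<^bsub>W\<^esub> inv\<^bsub>W\<^esub> u = v' \<otimes>\<^bsub>W\<^esub> inv\<^bsub>W\<^esub> u'"
  by (rule symmetric_generators.colored_digraph_isomorphic_iff
      [OF coxeter_system_symmetric_generators[OF assms(1)] assms(2-)])

end
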